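(* Let $A$ be an associative algebra and $\{\mathbf r^x=\sum r^x_{(1)}\otimes r^x_{(2)}\}_{x\in X}$ be a skew-symmetric matching associative $r$-matrix. Then the triple $(A,A^\star,\{P_x:A^\star\to A\}_{x\in X})$ is a matching relative Rota-Baxter algebra, where $P_x:A^\star\to A$ is given by $$P_x(\alpha):=\sum\alpha(r^x_{(2)})\,r^x_{(1)}=-\sum\alpha(r^x_{(1)})\,r^x_{(2)},\quad\text{for }\alpha\in A^\star,\ x\in X.$$
   Context: $\mathbb K$ is a commutative unital ring with $\mathrm{char}\,\mathbb K\neq 2$; all modules, linear maps and tensor products are over $\mathbb K$; $X$ is a nonempty set; $a\cdot b$ is the product of $A$. A matching relative Rota-Baxter algebra is a triple $(A,M,\{P_x\}_{x\in X})$ of an associative algebra $A$, an $A$-bimodule $M$ (actions denoted $\cdot_M$) and linear maps $P_x:M\to A$ such that $P_x(u)\cdot P_y(v)=P_x(u\cdot_M P_y(v))+P_y(P_x(u)\cdot_M v)$ for all $u,v\in M$, $x,y\in X$. $A^\star=\mathrm{Hom}(A,\mathbb K)$ carries the coadjoint $A$-bimodule structure, dual to the adjoint bimodule: $(a\cdot_{A^\star}\alpha)(b)=\alpha(b\cdot a)$ and $(\alpha\cdot_{A^\star}a)(b)=\alpha(a\cdot b)$ for $a,b\in A$, $\alpha\in A^\star$. For $\mathbf r=\sum r_{(1)}\otimes r_{(2)}$, $\mathbf s=\sum s_{(1)}\otimes s_{(2)}$ in $A\otimes A$ put, in $A\otimes A\otimes A$: $\mathbf r_{13}\mathbf s_{12}=\sum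 r_{(1)}\cdot s_{(1)}\otimes s_{(2)}\otimes r_{(2)}$, $\mathbf r_{12}\mathbf s_{23}=\sum r_{(1)}\otimes r_{(2)}\cdot s_{(1)}\otimes s_{(2)}$, $\mathbf r_{23}\mathbf s_{13}=\sum s_{(1)}\otimes r_{(1)}\otimes r_{(2)}\cdot s_{(2)}$. A collection $\{\mathbf r^x\}_{x\in X}$ of elements of $A\otimes A$ is a matching associative $r$-matrix if $\mathbf r^y_{13}\mathbf r^x_{12}-\mathbf r^x_{12}\mathbf r^y_{23}+\mathbf r^y_{23}\mathbf r^x_{13}=0$ for all $x,y\in X$ (the matching associative Yang-Baxter equation). It is skew-symmetric if $\mathbf r^x=-\sigma(\mathbf r^x)$ for all $x\in X$, where $\sigma(a\otimes b)=b\otimes a$. *)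

theory Defs
  imports
    Complex_Main
    "HOL-Library.Poly_Mapping"
    "HOL-Library.Function_Algebras"
    "HOL-Computational_Algebra.Primes"
begin

text \<open>Algebras are not assumed to be unital, hence the type class \<open>ring\<close>.\<close>

locale associative_algebra = module scale
  for scale :: "'k::comm_ring_1 \<Rightarrow> 'a::ring \<Rightarrow> 'a" +
  assumes scale_mult_left: "scale k a * b = scale k (a * b)"
    and scale_mult_right: "a * scale k b = scale k (a * b)"


text \<open>The underlying module of a bimodule is a submodule \<open>M\<close> of a module on a whole type, so that
  spaces of linear maps, which do not fill their function type, are covered.\<close>

locale bimodule =
  A: associative_algebra scaleA + M: module scaleM
  for scaleA :: "'k::comm_ring_1 \<Rightarrow> 'a::ring \<Rightarrow> 'a"
    and scaleM :: "'k \<Rightarrow> 'm::ab_group_add \<Rightarrow> 'm" +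
  fixes M :: "'m set"
    and lact :: "'a \<Rightarrow> 'm \<Rightarrow> 'm"
    and ract :: "'m \<Rightarrow> 'a \<Rightarrow> 'm"
  assumes subspace_M: "M.subspace M"
    and lact_closed: "u \<in> M \<Longrightarrow> lact a u \<in> M"
    and ract_closed: "u \<in> M \<Longrightarrow> ract u a \<in> M"
    and lact_add_left: "u \<in> M \<Longrightarrow> lact (a + b) u = lact a u + lact b u"
    and lact_add_right: "u \<in> M \<Longrightarrow> v \<in> M \<Longrightarrow> lact a (u + v) = lact a u + lact a v"
    and lact_scale_left: "u \<in> M \<Longrightarrow> lact (scaleA k a) u = scaleM k (lact a u)"
    and lact_scale_right: "u \<in> M \<Longrightarrow> lact a (scaleM k u) = scaleM k (lact a u)"
    and ract_add_left: "u \<in> M \<Longrightarrow> v \<in> M \<Longrightarrow> ract (u + v) a = ract u a + ract v a"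
    and ract_add_right: "u \<in> M \<Longrightarrow> ract u (a + b) = ract u a + ract u b"
    and ract_scale_left: "u \<in> M \<Longrightarrow> ract (scaleM k u) a = scaleM k (ract u a)"
    and ract_scale_right: "u \<in> M \<Longrightarrow> ract u (scaleA k a) = scaleM k (ract u a)"
    and lact_mult: "u \<in> M \<Longrightarrow> lact (a * b) u = lact a (lact b u)"
    and lact_ract: "u \<in> M \<Longrightarrow> ract (lact a u) b = lact a (ract u b)"
    and ract_mult: "u \<in> M \<Longrightarrow> ract u (a * b) = ract (ract u a) b"

locale matching_relative_Rota_Baxter_algebra =
  bimodule scaleA scaleM M lact ract
  for scaleA :: "'k::comm_ring_1 \<Rightarrow> 'a::ring \<Rightarrow> 'a"
    and scaleM :: "'k \<Rightarrow> 'm::ab_group_add \<Rightarrow> 'm"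
    and M lact ract +
  fixes X :: "'x set"
    and P :: "'x \<Rightarrow> 'm \<Rightarrow> 'a"
  assumes P_add: "x \<in> X \<Longrightarrow> u \<in> M \<Longrightarrow> v \<in> M \<Longrightarrow> P x (u + v) = P x u + P x v"
    and P_scale: "x \<in> X \<Longrightarrow> u \<in> M \<Longrightarrow> P x (scaleM k u) = scaleA k (P x u)"
    and P_matching: "x \<in> X \<Longrightarrow> y \<in> X \<Longrightarrow> u \<in> M \<Longrightarrow> v \<in> M \<Longrightarrow>
      P x u * P y v = P x (ract u (P y v)) + P y (lact (P x u) v)"


definition dual_space :: "('k::comm_ring_1 \<Rightarrow> 'a::ring \<Rightarrow> 'a) \<Rightarrow> ('a \<Rightarrow> 'k) set" where
  "dual_space scale = {\<alpha>. module_hom scale (*) \<alpha>}"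

definition dual_scale :: "'k::comm_ring_1 \<Rightarrow> ('a \<Rightarrow> 'k) \<Rightarrow> ('a \<Rightarrow> 'k)" where
  "dual_scale k \<alpha> = (\<lambda>b. k * \<alpha> b)"

definition coadjoint_left :: "'a::ring \<Rightarrow> ('a \<Rightarrow> 'k) \<Rightarrow> ('a \<Rightarrow> 'k)" where
  "coadjoint_left a \<alpha> = (\<lambda>b. \<alpha> (b * a))"

definition coadjoint_right :: "('a \<Rightarrow> 'k) \<Rightarrow> 'a::ring \<Rightarrow> ('a \<Rightarrow> 'k)" where
  "coadjoint_right \<alpha> a = (\<lambda>b. \<alpha> (a * b))"


text \<open>
  \<open>A \<otimes> A\<close> and \<open>A \<otimes> A \<otimes> A\<close> are the quotients of the free abelian groups on \<open>A \<times> A\<close> and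
  \<open>A \<times> A \<times> A\<close> by the subgroups generated by the usual relations. The scalar action is not
  determined by the type \<open>'a\<close>, so these quotients are sets of equivalence classes rather than
  types. An element of the free group is a formal sum of simple tensors; scalar coefficients are
  absorbed into the tensor factors.
\<close>

inductive_set tensor2_relators :: "('k \<Rightarrow> 'a::ring \<Rightarrow> 'a) \<Rightarrow> ('a \<times> 'a \<Rightarrow>\<^sub>0 int) set"
  for scale :: "'k \<Rightarrow> 'a::ring \<Rightarrow> 'a" where
  "frag_of (a + a', b) - frag_of (a, b) - frag_of (a', b) \<in> tensor2_relators scale"
| "frag_of (a, b + b') - frag_of (a, b) - frag_of (a, b') \<in> tensor2_relators scale"
| "frag_of (scale k a, b) - frag_of (a, scale k b) \<in> tensor2_relators scale"

inductive_set tensor3_relators :: "('k \<Rightarrow> 'a::ring \<Rightarrow> 'a) \<Rightarrow> ('a \<times> 'a \<times> 'a \<Rightarrow>\<^sub>0 int) set"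
  for scale :: "'k \<Rightarrow> 'a::ring \<Rightarrow> 'a" where
  "frag_of (a + a', b, c) - frag_of (a, b, c) - frag_of (a', b, c) \<in> tensor3_relators scale"
| "frag_of (a, b + b', c) - frag_of (a, b, c) - frag_of (a, b', c) \<in> tensor3_relators scale"
| "frag_of (a, b, c + c') - frag_of (a, b, c) - frag_of (a, b, c') \<in> tensor3_relators scale"
| "frag_of (scale k a, b, c) - frag_of (a, scale k b, c) \<in> tensor3_relators scale"
| "frag_of (a, scale k b, c) - frag_of (a, b, scale k c) \<in> tensor3_relators scale"

text \<open>\<open>module.span frag_cmul\<close> is the subgroup generated by a set (span over the integers).\<close>

definition relator_equiv :: "('b \<Rightarrow>\<^sub>0 int) set \<Rightarrow> (('b \<Rightarrow>\<^sub>0 int) \<times> ('b \<Rightarrow>\<^sub>0 int)) set" where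
  "relator_equiv R = {(f, g). f - g \<in> module.span frag_cmul R}"

abbreviation tensor2_equiv ::
  "('k \<Rightarrow> 'a::ring \<Rightarrow> 'a) \<Rightarrow> (('a \<times> 'a \<Rightarrow>\<^sub>0 int) \<times> ('a \<times> 'a \<Rightarrow>\<^sub>0 int)) set" where
  "tensor2_equiv scale \<equiv> relator_equiv (tensor2_relators scale)"

abbreviation tensor3_equiv ::
  "('k \<Rightarrow> 'a::ring \<Rightarrow> 'a) \<Rightarrow> (('a \<times> 'a \<times> 'a \<Rightarrow>\<^sub>0 int) \<times> ('a \<times> 'a \<times> 'a \<Rightarrow>\<^sub>0 int)) set" where
  "tensor3_equiv scale \<equiv> relator_equiv (tensor3_relators scale)"

definition tensor2 :: "('k \<Rightarrow> 'a::ring \<Rightarrow> 'a) \<Rightarrow> ('a \<times> 'a \<Rightarrow>\<^sub>0 int) set set" where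
  "tensor2 scale = UNIV // tensor2_equiv scale"

definition quot_zero :: "('c \<times> 'c) set \<Rightarrow> 'c::ab_group_add set" where
  "quot_zero E = E `` {0}"

definition quot_add :: "('c \<times> 'c) set \<Rightarrow> 'c::ab_group_add set \<Rightarrow> 'c set \<Rightarrow> 'c set" where
  "quot_add E r s = (\<Union>f\<in>r. \<Union>g\<in>s. E `` {f + g})"

definition quot_uminus :: "('c \<times> 'c) set \<Rightarrow> 'c::ab_group_add set \<Rightarrow> 'c set" where
  "quot_uminus E r = (\<Union>f\<in>r. E `` {- f})"

text \<open>Operations on tensors are defined on formal sums and then lifted to equivalence classes;
  the lemmas at the end of the theory show that they do not depend on representatives.\<close>

definition tensor_flip ::
  "('k \<Rightarrow> 'a::ring \<Rightarrow> 'a) \<Rightarrow> ('a \<times> 'a \<Rightarrow>\<^sub>0 int) set \<Rightarrow> ('a \<times> 'a \<Rightarrow>\<^sub>0 int) set" where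
  "tensor_flip scale r =
    (\<Union>f\<in>r. tensor2_equiv scale `` {frag_extend (\<lambda>(a, b). frag_of (b, a)) f})"

definition frag_bilift ::
  "('b \<Rightarrow> 'c \<Rightarrow> 'd) \<Rightarrow> ('b \<Rightarrow>\<^sub>0 int) \<Rightarrow> ('c \<Rightarrow>\<^sub>0 int) \<Rightarrow> ('d \<Rightarrow>\<^sub>0 int)" where
  "frag_bilift h f g = frag_extend (\<lambda>p. frag_extend (\<lambda>q. frag_of (h p q)) g) f"

definition prod_13_12 :: "('k \<Rightarrow> 'a::ring \<Rightarrow> 'a) \<Rightarrow> ('a \<times> 'a \<Rightarrow>\<^sub>0 int) set
    \<Rightarrow> ('a \<times> 'a \<Rightarrow>\<^sub>0 int) set \<Rightarrow> ('a \<times> 'a \<times> 'a \<Rightarrow>\<^sub>0 int) set" where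
  "prod_13_12 scale r s = (\<Union>f\<in>r. \<Union>g\<in>s. tensor3_equiv scale ``
    {frag_bilift (\<lambda>(r1, r2) (s1, s2). (r1 * s1, s2, r2)) f g})"

definition prod_12_23 :: "('k \<Rightarrow> 'a::ring \<Rightarrow> 'a) \<Rightarrow> ('a \<times> 'a \<Rightarrow>\<^sub>0 int) set
    \<Rightarrow> ('a \<times> 'a \<Rightarrow>\<^sub>0 int) set \<Rightarrow> ('a \<times> 'a \<times> 'a \<Rightarrow>\<^sub>0 int) set" where
  "prod_12_23 scale r s = (\<Union>f\<in>r. \<Union>g\<in>s. tensor3_equiv scale ``
    {frag_bilift (\<lambda>(r1, r2) (s1, s2). (r1, r2 * s1, s2)) f g})"

definition prod_23_13 :: "('k \<Rightarrow> 'a::ring \<Rightarrow> 'a) \<Rightarrow> ('a \<times> 'a \<Rightarrow>\<^sub>0 int) set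
    \<Rightarrow> ('a \<times> 'a \<Rightarrow>\<^sub>0 int) set \<Rightarrow> ('a \<times> 'a \<times> 'a \<Rightarrow>\<^sub>0 int) set" where
  "prod_23_13 scale r s = (\<Union>f\<in>r. \<Union>g\<in>s. tensor3_equiv scale ``
    {frag_bilift (\<lambda>(r1, r2) (s1, s2). (s1, r1, r2 * s2)) f g})"

definition matching_associative_r_matrix ::
  "('k::comm_ring_1 \<Rightarrow> 'a::ring \<Rightarrow> 'a) \<Rightarrow> 'x set \<Rightarrow> ('x \<Rightarrow> ('a \<times> 'a \<Rightarrow>\<^sub>0 int) set) \<Rightarrow> bool" where
  "matching_associative_r_matrix scale X r \<longleftrightarrow>
    (\<forall>x\<in>X. r x \<in> tensor2 scale) \<and>
    (\<forall>x\<in>X. \<forall>y\<in>X.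
      quot_add (tensor3_equiv scale)
        (quot_add (tensor3_equiv scale)
          (prod_13_12 scale (r y) (r x))
          (quot_uminus (tensor3_equiv scale) (prod_12_23 scale (r x) (r y))))
        (prod_23_13 scale (r y) (r x))
      = quot_zero (tensor3_equiv scale))"

definition skew_symmetric_family ::
  "('k \<Rightarrow> 'a::ring \<Rightarrow> 'a) \<Rightarrow> 'x set \<Rightarrow> ('x \<Rightarrow> ('a \<times> 'a \<Rightarrow>\<^sub>0 int) set) \<Rightarrow> bool" where
  "skew_symmetric_family scale X r \<longleftrightarrow>
    (\<forall>x\<in>X. r x = quot_uminus (tensor2_equiv scale) (tensor_flip scale (r x)))"

text \<open>For \<open>r = \<Sum> r1 \<otimes> r2\<close>, \<open>contract_snd\<close> is \<open>\<Sum> \<alpha>(r2) r1\<close> and \<open>contract_fst\<close> is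
  \<open>\<Sum> \<alpha>(r1) r2\<close>. The \<open>lookup\<close> factor counts the multiplicity of a simple tensor in the
  formal sum.\<close>

definition frag_contract_snd ::
  "('k::comm_ring_1 \<Rightarrow> 'a::ring \<Rightarrow> 'a) \<Rightarrow> ('a \<Rightarrow> 'k) \<Rightarrow> ('a \<times> 'a \<Rightarrow>\<^sub>0 int) \<Rightarrow> 'a" where
  "frag_contract_snd scale \<alpha> f =
    (\<Sum>(a, b)\<in>Poly_Mapping.keys f. scale (of_int (Poly_Mapping.lookup f (a, b)) * \<alpha> b) a)"

definition frag_contract_fst ::
  "('k::comm_ring_1 \<Rightarrow> 'a::ring \<Rightarrow> 'a) \<Rightarrow> ('a \<Rightarrow> 'k) \<Rightarrow> ('a \<times> 'a \<Rightarrow>\<^sub>0 int) \<Rightarrow> 'a" where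
  "frag_contract_fst scale \<alpha> f =
    (\<Sum>(a, b)\<in>Poly_Mapping.keys f. scale (of_int (Poly_Mapping.lookup f (a, b)) * \<alpha> a) b)"

definition contract_snd ::
  "('k::comm_ring_1 \<Rightarrow> 'a::ring \<Rightarrow> 'a) \<Rightarrow> ('a \<times> 'a \<Rightarrow>\<^sub>0 int) set \<Rightarrow> ('a \<Rightarrow> 'k) \<Rightarrow> 'a" where
  "contract_snd scale r \<alpha> = the_elem (\<Union>f\<in>r. {frag_contract_snd scale \<alpha> f})"

definition contract_fst ::
  "('k::comm_ring_1 \<Rightarrow> 'a::ring \<Rightarrow> 'a) \<Rightarrow> ('a \<times> 'a \<Rightarrow>\<^sub>0 int) set \<Rightarrow> ('a \<Rightarrow> 'k) \<Rightarrow> 'a" where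
  "contract_fst scale r \<alpha> = the_elem (\<Union>f\<in>r. {frag_contract_fst scale \<alpha> f})"


subsection \<open>Independence of representatives\<close>

interpretation frag_module: module frag_cmul
  by unfold_locales (simp_all add: frag_cmul_distrib frag_cmul_distrib2)

lemma equiv_relator_equiv: "equiv UNIV (relator_equiv R)"
proof (rule equivI)
  show "relator_equiv R \<subseteq> UNIV \<times> UNIV" by simp
  show "refl_on UNIV (relator_equiv R)"
    by (simp add: refl_on_def relator_equiv_def frag_module.span_zero)
  show "sym (relator_equiv R)"
    unfolding sym_def relator_equiv_def
    using frag_module.span_neg by fastforce
  show "trans (relator_equiv R)"
    unfolding trans_def relator_equiv_def
    using frag_module.span_add by fastforce
qed

lemma frag_extend_span:
  assumes f: "f \<in> module.span frag_cmul R"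
    and R: "\<And>t. t \<in> R \<Longrightarrow> frag_extend h t \<in> module.span frag_cmul S"
  shows "frag_extend h f \<in> module.span frag_cmul S"
  using f
proof (induction rule: frag_module.span_induct_alt)
  case base
  then show ?case by (simp add: frag_module.span_zero)
next
  case (step c x y)
  then show ?case
    by (simp add: frag_extend_add frag_extend_cmul R frag_module.span_add frag_module.span_scale)
qed

lemma frag_extend_in_span:
  assumes "\<And>p. h p \<in> module.span frag_cmul S"
  shows "frag_extend h f \<in> module.span frag_cmul S"
  unfolding frag_extend_def
  by (intro frag_module.span_sum frag_module.span_scale assms)

lemma frag_bilift_diff_left: "frag_bilift h (f - f') g = frag_bilift h f g - frag_bilift h f' g"
  by (simp add: frag_bilift_def frag_extend_diff)

lemma frag_extend_diff_fun:
  "frag_extend (\<lambda>p. h p - h' p) f = frag_extend h f - frag_extend h' f"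
  by (simp add: frag_extend_def frag_cmul_diff_distrib sum_subtractf
      frag_module.scale_right_diff_distrib)

lemma frag_bilift_diff_right: "frag_bilift h f (g - g') = frag_bilift h f g - frag_bilift h f g'"
  by (simp add: frag_bilift_def frag_extend_diff frag_extend_diff_fun)

lemma frag_bilift_of_left: "frag_bilift h (frag_of p) g = frag_extend (\<lambda>q. frag_of (h p q)) g"
  by (simp add: frag_bilift_def)

lemma frag_bilift_respects2:
  assumes L: "\<And>t q. t \<in> R \<Longrightarrow> frag_extend (\<lambda>p. frag_of (h p q)) t \<in> module.span frag_cmul S"
    and Rt: "\<And>t p. t \<in> R \<Longrightarrow> frag_extend (\<lambda>q. frag_of (h p q)) t \<in> module.span frag_cmul S"
  shows "(\<lambda>f g. relator_equiv S `` {frag_bilift h f g}) respects2 relator_equiv R"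
proof (rule congruent2I[OF equiv_relator_equiv equiv_relator_equiv])
  have swap: "frag_bilift h f g = frag_extend (\<lambda>q. frag_extend (\<lambda>p. frag_of (h p q)) f) g" for f g
    unfolding frag_bilift_def frag_extend_def
    by (simp add: frag_cmul_sum mult.commute sum.swap[of _ "Poly_Mapping.keys f"])
  have span: "frag_bilift h u g \<in> module.span frag_cmul S"
    if "u \<in> module.span frag_cmul R" for u g
    unfolding swap
    by (rule frag_extend_in_span) (rule frag_extend_span[OF that L])
  have span': "frag_bilift h f u \<in> module.span frag_cmul S"
    if "u \<in> module.span frag_cmul R" for u f
    unfolding frag_bilift_def
    by (rule frag_extend_in_span) (rule frag_extend_span[OF that Rt])
  show "relator_equiv S `` {frag_bilift h y z} = relator_equiv S `` {frag_bilift h y' z}"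
    if "(y, y') \<in> relator_equiv R" for y y' z
    using that span[of "y - y'" z]
    by (intro equiv_class_eq[OF equiv_relator_equiv])
      (simp add: relator_equiv_def frag_bilift_diff_left)
  show "relator_equiv S `` {frag_bilift h z y} = relator_equiv S `` {frag_bilift h z y'}"
    if "(y, y') \<in> relator_equiv R" for y y' z
    using that span'[of "y - y'" z]
    by (intro equiv_class_eq[OF equiv_relator_equiv])
      (simp add: relator_equiv_def frag_bilift_diff_right)
qed

lemma tensor3_scale_outer:
  "frag_of (scale k a, b, c) - frag_of (a, b, scale k c)
    \<in> module.span frag_cmul (tensor3_relators scale)"
proof -
  have "frag_of (scale k a, b, c) - frag_of (a, b, scale k c) =
    (frag_of (scale k a, b, c) - frag_of (a, scale k b, c)) +
    (frag_of (a, scale k b, c) - frag_of (a, b, scale k c))"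
    by simp
  then show ?thesis
    by (metis frag_module.span_add frag_module.span_base tensor3_relators.intros(4,5))
qed

lemmas tensor3_span = tensor3_relators.intros[THEN frag_module.span_base]

context associative_algebra
begin

lemma prod_13_12_respects2:
  "(\<lambda>f g. tensor3_equiv scale `` {frag_bilift (\<lambda>(r1, r2) (s1, s2). (r1 * s1, s2, r2)) f g})
    respects2 tensor2_equiv scale"
  by (rule frag_bilift_respects2; erule tensor2_relators.cases; clarify;
      auto simp: frag_extend_diff distrib_left distrib_right scale_mult_left scale_mult_right
        intro: tensor3_span tensor3_scale_outer)

lemma prod_12_23_respects2:
  "(\<lambda>f g. tensor3_equiv scale `` {frag_bilift (\<lambda>(r1, r2) (s1, s2). (r1, r2 * s1, s2)) f g})
    respects2 tensor2_equiv scale"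
  by (rule frag_bilift_respects2; erule tensor2_relators.cases; clarify;
      auto simp: frag_extend_diff distrib_left distrib_right scale_mult_left scale_mult_right
        intro: tensor3_span tensor3_scale_outer)

lemma prod_23_13_respects2:
  "(\<lambda>f g. tensor3_equiv scale `` {frag_bilift (\<lambda>(r1, r2) (s1, s2). (s1, r1, r2 * s2)) f g})
    respects2 tensor2_equiv scale"
  by (rule frag_bilift_respects2; erule tensor2_relators.cases; clarify;
      auto simp: frag_extend_diff distrib_left distrib_right scale_mult_left scale_mult_right
        intro: tensor3_span tensor3_scale_outer)

lemma additive_frag_contract_snd: "additive (frag_contract_snd scale \<alpha>)"
proof
  fix f g :: "'a \<times> 'a \<Rightarrow>\<^sub>0 int"
  let ?K = "Poly_Mapping.keys f \<union> Poly_Mapping.keys g"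
  have *: "frag_contract_snd scale \<alpha> u =
      (\<Sum>(a, b)\<in>?K. scale (of_int (Poly_Mapping.lookup u (a, b)) * \<alpha> b) a)"
    if "Poly_Mapping.keys u \<subseteq> ?K" for u
    unfolding frag_contract_snd_def
    by (rule sum.mono_neutral_left) (use that in \<open>auto simp: in_keys_iff\<close>)
  show "frag_contract_snd scale \<alpha> (f + g) = frag_contract_snd scale \<alpha> f + frag_contract_snd scale \<alpha> g"
    by (simp add: * Poly_Mapping.keys_add lookup_add scale_left_distrib distrib_right
        sum.distrib case_prod_unfold)
qed

lemma additive_frag_contract_fst: "additive (frag_contract_fst scale \<alpha>)"
proof
  fix f g :: "'a \<times> 'a \<Rightarrow>\<^sub>0 int"
  let ?K = "Poly_Mapping.keys f \<union> Poly_Mapping.keys g"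
  have *: "frag_contract_fst scale \<alpha> u =
      (\<Sum>(a, b)\<in>?K. scale (of_int (Poly_Mapping.lookup u (a, b)) * \<alpha> a) b)"
    if "Poly_Mapping.keys u \<subseteq> ?K" for u
    unfolding frag_contract_fst_def
    by (rule sum.mono_neutral_left) (use that in \<open>auto simp: in_keys_iff\<close>)
  show "frag_contract_fst scale \<alpha> (f + g) = frag_contract_fst scale \<alpha> f + frag_contract_fst scale \<alpha> g"
    by (simp add: * Poly_Mapping.keys_add lookup_add scale_left_distrib distrib_right
        sum.distrib case_prod_unfold)
qed

lemma frag_contract_of [simp]:
  "frag_contract_snd scale \<alpha> (frag_of (a, b)) = scale (\<alpha> b) a"
  "frag_contract_fst scale \<alpha> (frag_of (a, b)) = scale (\<alpha> a) b"
  by (simp_all add: frag_contract_snd_def frag_contract_fst_def)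

lemma additive_respects:
  assumes F: "additive (F :: ('b \<Rightarrow>\<^sub>0 int) \<Rightarrow> 'c::ab_group_add)" and R: "\<And>t. t \<in> R \<Longrightarrow> F t = 0"
  shows "F respects relator_equiv R"
proof (rule congruentI)
  interpret F: additive F by (rule F)
  have cmul: "F (frag_cmul c t) = 0" if "F t = 0" for c t
  proof (rule frag_closure_minus_cmul[where P = "\<lambda>u. F u = 0"])
  qed (simp_all add: F.diff F.zero that)
  have "F u = 0" if "u \<in> module.span frag_cmul R" for u
    using that by (induction rule: frag_module.span_induct_alt) (simp_all add: F.zero F.add cmul R)
  then show "F y = F z" if "(y, z) \<in> relator_equiv R" for y z
    using that F.diff[of y z] by (simp add: relator_equiv_def)
qed

lemma frag_contract_snd_respects:
  assumes "\<alpha> \<in> dual_space scale"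
  shows "frag_contract_snd scale \<alpha> respects tensor2_equiv scale"
proof -
  interpret F: additive "frag_contract_snd scale \<alpha>" by (rule additive_frag_contract_snd)
  interpret \<alpha>: module_hom scale "(*)" \<alpha> using assms by (simp add: dual_space_def)
  show ?thesis
    by (rule additive_respects[OF additive_frag_contract_snd], erule tensor2_relators.cases)
      (simp_all add: F.diff \<alpha>.add \<alpha>.scale scale_left_distrib scale_right_distrib mult.commute)
qed

lemma frag_contract_fst_respects:
  assumes "\<alpha> \<in> dual_space scale"
  shows "frag_contract_fst scale \<alpha> respects tensor2_equiv scale"
proof -
  interpret F: additive "frag_contract_fst scale \<alpha>" by (rule additive_frag_contract_fst)
  interpret \<alpha>: module_hom scale "(*)" \<alpha> using assms by (simp add: dual_space_def)
  show ?thesis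
    by (rule additive_respects[OF additive_frag_contract_fst], erule tensor2_relators.cases)
      (simp_all add: F.diff \<alpha>.add \<alpha>.scale scale_left_distrib scale_right_distrib mult.commute)
qed

lemma contract_snd_class:
  assumes "\<alpha> \<in> dual_space scale"
  shows "contract_snd scale (tensor2_equiv scale `` {f}) \<alpha> = frag_contract_snd scale \<alpha> f"
proof -
  have "(\<lambda>g. {frag_contract_snd scale \<alpha> g}) respects tensor2_equiv scale"
    using frag_contract_snd_respects[OF assms] by (simp add: congruent_def)
  from UN_equiv_class[OF equiv_relator_equiv this] show ?thesis
    by (simp add: contract_snd_def)
qed

lemma contract_fst_class:
  assumes "\<alpha> \<in> dual_space scale"
  shows "contract_fst scale (tensor2_equiv scale `` {f}) \<alpha> = frag_contract_fst scale \<alpha> f"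
proof -
  have "(\<lambda>g. {frag_contract_fst scale \<alpha> g}) respects tensor2_equiv scale"
    using frag_contract_fst_respects[OF assms] by (simp add: congruent_def)
  from UN_equiv_class[OF equiv_relator_equiv this] show ?thesis
    by (simp add: contract_fst_def)
qed

lemma tensor_flip_class:
  "tensor_flip scale (tensor2_equiv scale `` {f}) =
    tensor2_equiv scale `` {frag_extend (\<lambda>(a, b). frag_of (b, a)) f}"
  unfolding tensor_flip_def
proof (rule UN_equiv_class[OF equiv_relator_equiv])
  let ?\<sigma> = "frag_extend (\<lambda>(a, b). frag_of (b, a :: 'a))"
  let ?N = "module.span frag_cmul (tensor2_relators scale)"
  have "?\<sigma> t \<in> ?N" if t: "t \<in> tensor2_relators scale" for t
    using t
  proof cases
    case (3 k a b)
    have "- (frag_of (scale k b, a) - frag_of (b, scale k a)) \<in> ?N"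
      by (intro frag_module.span_neg frag_module.span_base tensor2_relators.intros)
    then show ?thesis using 3 by (simp add: frag_extend_diff)
  qed (auto simp: frag_extend_diff intro!: frag_module.span_base tensor2_relators.intros)
  then have "?\<sigma> u \<in> ?N" if "u \<in> ?N" for u
    using that by (rule frag_extend_span[rotated])
  then show "(\<lambda>f. tensor2_equiv scale `` {?\<sigma> f}) respects tensor2_equiv scale"
    by (intro congruentI equiv_class_eq[OF equiv_relator_equiv])
      (simp add: relator_equiv_def flip: frag_extend_diff)
qed simp

lemmas prod_13_12_class = UN_equiv_class2[OF equiv_relator_equiv equiv_relator_equiv
    prod_13_12_respects2 UNIV_I UNIV_I, folded prod_13_12_def]
lemmas prod_12_23_class = UN_equiv_class2[OF equiv_relator_equiv equiv_relator_equiv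
    prod_12_23_respects2 UNIV_I UNIV_I, folded prod_12_23_def]
lemmas prod_23_13_class = UN_equiv_class2[OF equiv_relator_equiv equiv_relator_equiv
    prod_23_13_respects2 UNIV_I UNIV_I, folded prod_23_13_def]

end

lemma quot_add_class:
  "quot_add (relator_equiv R) (relator_equiv R `` {f}) (relator_equiv R `` {g}) =
    relator_equiv R `` {f + g}"
  unfolding quot_add_def
proof (rule UN_equiv_class2[OF equiv_relator_equiv equiv_relator_equiv])
  show "(\<lambda>f g. relator_equiv R `` {f + g}) respects2 relator_equiv R"
    by (rule congruent2I[OF equiv_relator_equiv equiv_relator_equiv];
        intro equiv_class_eq[OF equiv_relator_equiv]) (simp_all add: relator_equiv_def)
qed simp_all

lemma quot_uminus_class:
  "quot_uminus (relator_equiv R) (relator_equiv R `` {f}) = relator_equiv R `` {- f}"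
  unfolding quot_uminus_def
proof (rule UN_equiv_class[OF equiv_relator_equiv])
  show "(\<lambda>f. relator_equiv R `` {- f}) respects relator_equiv R"
  proof (intro congruentI equiv_class_eq[OF equiv_relator_equiv])
    fix y z assume "(y, z) \<in> relator_equiv R"
    then have "- (y - z) \<in> module.span frag_cmul R"
      unfolding relator_equiv_def by (blast intro: frag_module.span_neg)
    then show "(- y, - z) \<in> relator_equiv R" by (simp add: relator_equiv_def)
  qed
qed simp

end

theory Submission
  imports Defs
begin

text \<open>
  Write \<open>r\<^sup>x = \<Sum> a \<otimes> b\<close> and \<open>r\<^sup>y = \<Sum> c \<otimes> d\<close>. The matching Yang-Baxter equation for \<open>x, y\<close> reads
  \<open>\<Sum> ca \<otimes> b \<otimes> d - \<Sum> a \<otimes> bc \<otimes> d + \<Sum> a \<otimes> c \<otimes> db = 0\<close>. Applying \<open>\<alpha> \<otimes> id \<otimes> \<beta>\<close> to it, and writing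
  \<open>Q\<^sub>x(\<alpha>) = \<Sum> \<alpha>(a) b\<close> next to \<open>P\<^sub>x(\<alpha>) = \<Sum> \<alpha>(b) a\<close>, gives
  \<open>Q\<^sub>x(\<alpha> \<cdot> P\<^sub>y(\<beta>)) - Q\<^sub>x(\<alpha>) P\<^sub>y(\<beta>) + P\<^sub>y(Q\<^sub>x(\<alpha>) \<cdot> \<beta>) = 0\<close>.
  Skew-symmetry says \<open>Q\<^sub>x = - P\<^sub>x\<close>, and the substitution turns this into the matching Rota-Baxter
  identity \<open>P\<^sub>x(\<alpha>) P\<^sub>y(\<beta>) = P\<^sub>x(\<alpha> \<cdot> P\<^sub>y(\<beta>)) + P\<^sub>y(P\<^sub>x(\<alpha>) \<cdot> \<beta>)\<close>.

  It matters which tensor factor survives. Keeping the first factor instead leads to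
  \<open>P\<^sub>y(\<beta>) P\<^sub>x(\<alpha>) = P\<^sub>x(P\<^sub>y(\<beta>) \<cdot> \<alpha>) + P\<^sub>x(\<beta> \<cdot> P\<^sub>y(\<alpha>))\<close>, with the same outer operator in both terms on
  the right, and keeping the third factor gives \<open>P\<^sub>y\<close> twice in the same way; for \<open>x \<noteq> y\<close> neither has
  the form of the matching Rota-Baxter identity.

  The three contracted terms are computed in the lemmas \<open>contract_outer_13_12\<close>,
  \<open>contract_outer_12_23\<close> and \<open>contract_outer_23_13\<close>. Tensors are classes of formal integer sums of
  simple tensors, so each computation compares two biadditive maps on formal sums, which need only
  be checked on simple tensors.
\<close>

section \<open>Additive maps on formal sums\<close>

lemma additive_frag_eqI:
  assumes F: "additive (F :: ('b \<Rightarrow>\<^sub>0 int) \<Rightarrow> 'c::ab_group_add)" and G: "additive G"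
    and gen: "\<And>p. F (frag_of p) = G (frag_of p)"
  shows "F f = G f"
proof -
  interpret F: additive F by (rule F)
  interpret G: additive G by (rule G)
  show ?thesis
    using subset_UNIV[of "Poly_Mapping.keys f"]
    by (induction f rule: frag_induction)
      (simp_all add: F.zero G.zero F.diff G.diff gen)
qed

lemma biadditive_frag_eqI:
  assumes "\<And>g. additive (\<lambda>f. B f g)" and "\<And>f. additive (B f)"
    and "\<And>g. additive (\<lambda>f. C f g)" and "\<And>f. additive (C f)"
    and gen: "\<And>p q. B (frag_of p) (frag_of q) = C (frag_of p) (frag_of q)"
  shows "B f g = (C f g :: 'c::ab_group_add)"
proof -
  have "B (frag_of p) g = C (frag_of p) g" for p
    using assms(2,4) gen by (rule additive_frag_eqI)
  then show ?thesis
    using additive_frag_eqI[OF assms(1,3)] by blast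
qed

lemma additive_compose_frag_bilift:
  assumes "additive (T :: ('d \<Rightarrow>\<^sub>0 int) \<Rightarrow> 'e::ab_group_add)"
  shows "additive (\<lambda>f. T (frag_bilift h f g))" and "additive (\<lambda>g. T (frag_bilift h f g))"
proof -
  interpret T: additive T by (rule assms)
  have "frag_bilift h f (g + g') = frag_bilift h f g + frag_bilift h f g'" for f g g'
    using frag_bilift_diff_right[of h f "g + g'" g'] by (simp add: eq_diff_eq)
  then show "additive (\<lambda>g. T (frag_bilift h f g))"
    by unfold_locales (simp add: T.add)
  show "additive (\<lambda>f. T (frag_bilift h f g))"
    by unfold_locales (simp add: frag_bilift_def frag_extend_add T.add)
qed


section \<open>The coadjoint bimodule\<close>

context associative_algebra
begin

lemma coadjoint_left_dual:
  assumes "\<alpha> \<in> dual_space scale"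
  shows "coadjoint_left a \<alpha> \<in> dual_space scale"
proof -
  interpret \<alpha>: module_hom scale "(*)" \<alpha> using assms by (simp add: dual_space_def)
  show ?thesis
    unfolding dual_space_def coadjoint_left_def mem_Collect_eq
    by unfold_locales (simp_all add: distrib_right scale_mult_left \<alpha>.add \<alpha>.scale)
qed

lemma coadjoint_right_dual:
  assumes "\<alpha> \<in> dual_space scale"
  shows "coadjoint_right \<alpha> a \<in> dual_space scale"
proof -
  interpret \<alpha>: module_hom scale "(*)" \<alpha> using assms by (simp add: dual_space_def)
  show ?thesis
    unfolding dual_space_def coadjoint_right_def mem_Collect_eq
    by unfold_locales (simp_all add: distrib_left scale_mult_right \<alpha>.add \<alpha>.scale)
qed

lemma bimodule_coadjoint:
  "bimodule scale dual_scale (dual_space scale) coadjoint_left coadjoint_right"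
proof -
  interpret D: module "dual_scale :: 'k \<Rightarrow> ('a \<Rightarrow> 'k) \<Rightarrow> 'a \<Rightarrow> 'k"
    by unfold_locales (auto simp: dual_scale_def fun_eq_iff algebra_simps)
  have hom: "\<alpha> (a + b) = \<alpha> a + \<alpha> b" "\<alpha> (scale k a) = k * \<alpha> a"
    if "\<alpha> \<in> dual_space scale" for \<alpha> a b k
  proof -
    interpret \<alpha>: module_hom scale "(*)" \<alpha> using that by (simp add: dual_space_def)
    show "\<alpha> (a + b) = \<alpha> a + \<alpha> b" "\<alpha> (scale k a) = k * \<alpha> a"
      by (rule \<alpha>.add \<alpha>.scale)+
  qed
  have dualI: "\<alpha> \<in> dual_space scale"
    if "\<And>a b. \<alpha> (a + b) = \<alpha> a + \<alpha> b" "\<And>k a. \<alpha> (scale k a) = k * \<alpha> a" for \<alpha>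
    unfolding dual_space_def mem_Collect_eq
    by unfold_locales (simp_all add: that algebra_simps)
  have sub: "D.subspace (dual_space scale)"
    unfolding D.subspace_def
    by (auto intro!: dualI simp: hom dual_scale_def algebra_simps)
  show ?thesis
    by unfold_locales
      (auto simp: sub coadjoint_left_dual coadjoint_right_dual,
       auto simp: coadjoint_left_def coadjoint_right_def dual_scale_def fun_eq_iff hom
         scale_mult_left scale_mult_right algebra_simps)
qed


section \<open>Contractions of two-tensors\<close>

lemma frag_contract_functional_add:
  "frag_contract_snd scale (\<alpha> + \<beta>) f = frag_contract_snd scale \<alpha> f + frag_contract_snd scale \<beta> f"
  "frag_contract_fst scale (\<alpha> + \<beta>) f = frag_contract_fst scale \<alpha> f + frag_contract_fst scale \<beta> f"
  by (simp_all add: frag_contract_snd_def frag_contract_fst_def case_prod_unfold distrib_left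
      scale_left_distrib sum.distrib)

lemma frag_contract_snd_dual_scale:
  "frag_contract_snd scale (dual_scale k \<alpha>) f = scale k (frag_contract_snd scale \<alpha> f)"
  by (simp add: frag_contract_snd_def case_prod_unfold dual_scale_def scale_sum_right
      mult.left_commute)

lemma tensor2_class_exists:
  assumes "t \<in> tensor2 scale"
  obtains f where "t = tensor2_equiv scale `` {f}"
  using assms unfolding tensor2_def by (auto elim: quotientE)

lemma contract_snd_flip:
  "frag_contract_snd scale \<alpha> (frag_extend (\<lambda>(a, b). frag_of (b, a)) f) =
    frag_contract_fst scale \<alpha> f"
proof (rule additive_frag_eqI)
  interpret S: additive "frag_contract_snd scale \<alpha>" by (rule additive_frag_contract_snd)
  show "additive (\<lambda>f. frag_contract_snd scale \<alpha> (frag_extend (\<lambda>(a, b). frag_of (b, a)) f))"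
    by unfold_locales (simp add: frag_extend_add S.add)
qed (auto simp: additive_frag_contract_fst)

lemma contract_snd_eq_minus_contract_fst:
  assumes t: "t \<in> tensor2 scale"
    and skew: "t = quot_uminus (tensor2_equiv scale) (tensor_flip scale t)"
    and \<alpha>: "\<alpha> \<in> dual_space scale"
  shows "contract_snd scale t \<alpha> = - contract_fst scale t \<alpha>"
proof -
  interpret S: additive "frag_contract_snd scale \<alpha>" by (rule additive_frag_contract_snd)
  obtain f where f: "t = tensor2_equiv scale `` {f}"
    using t by (rule tensor2_class_exists)
  have "t = tensor2_equiv scale `` {- frag_extend (\<lambda>(a, b). frag_of (b, a)) f}"
    using skew unfolding f tensor_flip_class quot_uminus_class .
  then have "contract_snd scale t \<alpha> =
      frag_contract_snd scale \<alpha> (- frag_extend (\<lambda>(a, b). frag_of (b, a)) f)"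
    using contract_snd_class[OF \<alpha>] by simp
  also have "\<dots> = - contract_fst scale t \<alpha>"
    by (simp add: S.minus contract_snd_flip f contract_fst_class[OF \<alpha>])
  finally show ?thesis .
qed


section \<open>Contracting the outer factors of a three-tensor\<close>

text \<open>This is \<open>\<alpha> \<otimes> id \<otimes> \<beta>\<close> on formal sums.\<close>

definition contract_outer :: "('a \<Rightarrow> 'k) \<Rightarrow> ('a \<Rightarrow> 'k) \<Rightarrow> ('a \<times> 'a \<times> 'a \<Rightarrow>\<^sub>0 int) \<Rightarrow> 'a" where
  "contract_outer \<alpha> \<beta> f =
    (\<Sum>(a, b, c)\<in>Poly_Mapping.keys f. scale (of_int (Poly_Mapping.lookup f (a, b, c)) * (\<alpha> a * \<beta> c)) b)"

lemma additive_contract_outer: "additive (contract_outer \<alpha> \<beta>)"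
proof
  fix f g :: "'a \<times> 'a \<times> 'a \<Rightarrow>\<^sub>0 int"
  let ?K = "Poly_Mapping.keys f \<union> Poly_Mapping.keys g"
  have *: "contract_outer \<alpha> \<beta> u =
      (\<Sum>(a, b, c)\<in>?K. scale (of_int (Poly_Mapping.lookup u (a, b, c)) * (\<alpha> a * \<beta> c)) b)"
    if "Poly_Mapping.keys u \<subseteq> ?K" for u
    unfolding contract_outer_def
    by (rule sum.mono_neutral_left) (use that in \<open>auto simp: in_keys_iff\<close>)
  show "contract_outer \<alpha> \<beta> (f + g) = contract_outer \<alpha> \<beta> f + contract_outer \<alpha> \<beta> g"
    by (simp add: * Poly_Mapping.keys_add lookup_add scale_left_distrib distrib_right
        sum.distrib case_prod_unfold)
qed

lemma contract_outer_of [simp]: "contract_outer \<alpha> \<beta> (frag_of (a, b, c)) = scale (\<alpha> a * \<beta> c) b"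
  by (simp add: contract_outer_def)

text \<open>Linear functionals respect the relations of the tensor product, hence a formal sum that
  represents the zero tensor contracts to zero.\<close>

lemma contract_outer_eq_0:
  assumes \<alpha>: "\<alpha> \<in> dual_space scale" and \<beta>: "\<beta> \<in> dual_space scale"
    and f: "tensor3_equiv scale `` {f} = quot_zero (tensor3_equiv scale)"
  shows "contract_outer \<alpha> \<beta> f = 0"
proof -
  interpret T: additive "contract_outer \<alpha> \<beta>" by (rule additive_contract_outer)
  interpret \<alpha>: module_hom scale "(*)" \<alpha> using \<alpha> by (simp add: dual_space_def)
  interpret \<beta>: module_hom scale "(*)" \<beta> using \<beta> by (simp add: dual_space_def)
  have "contract_outer \<alpha> \<beta> respects tensor3_equiv scale"
    by (rule additive_respects[OF additive_contract_outer], erule tensor3_relators.cases)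
      (simp_all only: T.diff contract_outer_of,
       simp_all add: \<alpha>.add \<alpha>.scale \<beta>.add \<beta>.scale distrib_left distrib_right
         scale_left_distrib scale_right_distrib,
       simp_all only: mult_ac)
  moreover have "(f, 0) \<in> tensor3_equiv scale"
    using f eq_equiv_class_iff[OF equiv_relator_equiv] by (auto simp: quot_zero_def)
  ultimately show ?thesis
    using T.zero by (auto dest: congruentD)
qed

text \<open>In \<open>\<Sum> ca \<otimes> b \<otimes> d\<close> the functional \<open>\<beta>\<close> only meets \<open>d\<close>, so \<open>c\<close> can be summed first, to
  \<open>\<Sum> \<beta>(d) c\<close>; multiplying \<open>a\<close> by this element on the left before applying \<open>\<alpha>\<close> is the right
  coadjoint action. The last of the three lemmas is the mirror image: there \<open>\<alpha>\<close> meets only \<open>a\<close>, and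
  the element \<open>\<Sum> \<alpha>(a) b\<close> on the right of \<open>d\<close> acts on \<open>\<beta>\<close> from the left.\<close>

lemma contract_outer_13_12:
  assumes "\<alpha> \<in> dual_space scale"
  shows "contract_outer \<alpha> \<beta> (frag_bilift (\<lambda>(r1, r2) (s1, s2). (r1 * s1, s2, r2)) g f) =
    frag_contract_fst scale (coadjoint_right \<alpha> (frag_contract_snd scale \<beta> g)) f"
proof (rule biadditive_frag_eqI)
  interpret \<alpha>: module_hom scale "(*)" \<alpha> using assms by (simp add: dual_space_def)
  interpret S: additive "frag_contract_snd scale \<beta>" by (rule additive_frag_contract_snd)
  have "coadjoint_right \<alpha> (a + b) = coadjoint_right \<alpha> a + coadjoint_right \<alpha> b" for a b
    by (simp add: coadjoint_right_def fun_eq_iff distrib_right \<alpha>.add)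
  then show "additive (\<lambda>g. frag_contract_fst scale
      (coadjoint_right \<alpha> (frag_contract_snd scale \<beta> g)) f)" for f
    by unfold_locales (simp add: S.add frag_contract_functional_add)
  show "contract_outer \<alpha> \<beta>
      (frag_bilift (\<lambda>(r1, r2) (s1, s2). (r1 * s1, s2, r2)) (frag_of p) (frag_of q)) =
    frag_contract_fst scale (coadjoint_right \<alpha> (frag_contract_snd scale \<beta> (frag_of p)))
      (frag_of q)" for p q
    by (cases p; cases q)
      (simp add: frag_bilift_def coadjoint_right_def scale_mult_left \<alpha>.scale mult.commute)
qed (rule additive_compose_frag_bilift additive_contract_outer additive_frag_contract_fst)+

lemma contract_outer_12_23:
  "contract_outer \<alpha> \<beta> (frag_bilift (\<lambda>(r1, r2) (s1, s2). (r1, r2 * s1, s2)) f g) =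
    frag_contract_fst scale \<alpha> f * frag_contract_snd scale \<beta> g"
proof (rule biadditive_frag_eqI)
  interpret F: additive "frag_contract_fst scale \<alpha>" by (rule additive_frag_contract_fst)
  interpret S: additive "frag_contract_snd scale \<beta>" by (rule additive_frag_contract_snd)
  show "additive (\<lambda>f. frag_contract_fst scale \<alpha> f * frag_contract_snd scale \<beta> g)" for g
    by unfold_locales (simp add: F.add distrib_right)
  show "additive (\<lambda>g. frag_contract_fst scale \<alpha> f * frag_contract_snd scale \<beta> g)" for f
    by unfold_locales (simp add: S.add distrib_left)
  show "contract_outer \<alpha> \<beta>
      (frag_bilift (\<lambda>(r1, r2) (s1, s2). (r1, r2 * s1, s2)) (frag_of p) (frag_of q)) =
    frag_contract_fst scale \<alpha> (frag_of p) * frag_contract_snd scale \<beta> (frag_of q)" for p q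
    by (cases p; cases q)
      (simp add: frag_bilift_def scale_mult_left scale_mult_right mult.commute)
qed (rule additive_compose_frag_bilift additive_contract_outer)+

lemma contract_outer_23_13:
  assumes "\<beta> \<in> dual_space scale"
  shows "contract_outer \<alpha> \<beta> (frag_bilift (\<lambda>(r1, r2) (s1, s2). (s1, r1, r2 * s2)) g f) =
    frag_contract_snd scale (coadjoint_left (frag_contract_fst scale \<alpha> f) \<beta>) g"
proof (rule biadditive_frag_eqI)
  interpret \<beta>: module_hom scale "(*)" \<beta> using assms by (simp add: dual_space_def)
  interpret F: additive "frag_contract_fst scale \<alpha>" by (rule additive_frag_contract_fst)
  have "coadjoint_left (a + b) \<beta> = coadjoint_left a \<beta> + coadjoint_left b \<beta>" for a b
    by (simp add: coadjoint_left_def fun_eq_iff distrib_left \<beta>.add)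
  then show "additive (\<lambda>f. frag_contract_snd scale
      (coadjoint_left (frag_contract_fst scale \<alpha> f) \<beta>) g)" for g
    by unfold_locales (simp add: F.add frag_contract_functional_add)
  show "contract_outer \<alpha> \<beta>
      (frag_bilift (\<lambda>(r1, r2) (s1, s2). (s1, r1, r2 * s2)) (frag_of p) (frag_of q)) =
    frag_contract_snd scale (coadjoint_left (frag_contract_fst scale \<alpha> (frag_of q)) \<beta>)
      (frag_of p)" for p q
    by (cases p; cases q)
      (simp add: frag_bilift_def coadjoint_left_def scale_mult_right \<beta>.scale)
qed (rule additive_compose_frag_bilift additive_contract_outer additive_frag_contract_snd)+

text \<open>This is the image of the Yang-Baxter equation under \<open>\<alpha> \<otimes> id \<otimes> \<beta>\<close>. Both contractions occur
  because \<open>\<alpha>\<close> pairs with the first factor of \<open>r x\<close> and \<open>\<beta>\<close> with the second factor of \<open>r y\<close>;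
  skew-symmetry makes the two contractions agree up to sign.\<close>

lemma contracted_matching_Yang_Baxter:
  assumes r: "matching_associative_r_matrix scale X r" and "x \<in> X" "y \<in> X"
    and \<alpha>: "\<alpha> \<in> dual_space scale" and \<beta>: "\<beta> \<in> dual_space scale"
  shows "contract_fst scale (r x) (coadjoint_right \<alpha> (contract_snd scale (r y) \<beta>))
    - contract_fst scale (r x) \<alpha> * contract_snd scale (r y) \<beta>
    + contract_snd scale (r y) (coadjoint_left (contract_fst scale (r x) \<alpha>) \<beta>) = 0"
proof -
  interpret T: additive "contract_outer \<alpha> \<beta>" by (rule additive_contract_outer)
  have "r x \<in> tensor2 scale" "r y \<in> tensor2 scale"
    using assms by (simp_all add: matching_associative_r_matrix_def)
  then obtain f g where f: "r x = tensor2_equiv scale `` {f}"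
    and g: "r y = tensor2_equiv scale `` {g}"
    by (metis tensor2_class_exists)
  let ?t = "frag_bilift (\<lambda>(r1, r2) (s1, s2). (r1 * s1, s2, r2)) g f
    + - frag_bilift (\<lambda>(r1, r2) (s1, s2). (r1, r2 * s1, s2)) f g
    + frag_bilift (\<lambda>(r1, r2) (s1, s2). (s1, r1, r2 * s2)) g f"
  have "tensor3_equiv scale `` {?t} =
    quot_add (tensor3_equiv scale)
      (quot_add (tensor3_equiv scale)
        (prod_13_12 scale (r y) (r x))
        (quot_uminus (tensor3_equiv scale) (prod_12_23 scale (r x) (r y))))
      (prod_23_13 scale (r y) (r x))"
    unfolding f g prod_13_12_class prod_12_23_class prod_23_13_class quot_add_class
      quot_uminus_class ..
  also have "\<dots> = quot_zero (tensor3_equiv scale)"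
    using r \<open>x \<in> X\<close> \<open>y \<in> X\<close> unfolding matching_associative_r_matrix_def by blast
  finally have "contract_outer \<alpha> \<beta> ?t = 0"
    by (rule contract_outer_eq_0[OF \<alpha> \<beta>])
  then show ?thesis
    by (simp add: T.add T.diff contract_outer_13_12[OF \<alpha>] contract_outer_12_23
        contract_outer_23_13[OF \<beta>] f g contract_snd_class contract_fst_class \<alpha> \<beta>
        coadjoint_left_dual coadjoint_right_dual)
qed

end


section \<open>The Rota-Baxter operators of a skew-symmetric r-matrix\<close>

theorem proposition3p9:
  fixes scale :: "'k::comm_ring_1 \<Rightarrow> 'a::ring \<Rightarrow> 'a"
    and X :: "'x set"
    and r :: "'x \<Rightarrow> ('a \<times> 'a \<Rightarrow>\<^sub>0 int) set"
  assumes "CHAR('k) \<noteq> 2"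
    and "X \<noteq> {}"
    and "associative_algebra scale"
    and "matching_associative_r_matrix scale X r"
    and "skew_symmetric_family scale X r"
  shows "(\<forall>x\<in>X. \<forall>\<alpha>\<in>dual_space scale.
            contract_snd scale (r x) \<alpha> = - contract_fst scale (r x) \<alpha>) \<and>
         matching_relative_Rota_Baxter_algebra scale dual_scale
           (dual_space scale) coadjoint_left coadjoint_right X
           (\<lambda>x \<alpha>. contract_snd scale (r x) \<alpha>)"
proof -
  interpret associative_algebra scale by fact
  interpret B: bimodule scale dual_scale "dual_space scale" coadjoint_left coadjoint_right
    by (rule bimodule_coadjoint)
  have r_tensor: "r x \<in> tensor2 scale" if "x \<in> X" for x
    using assms(4) that by (simp add: matching_associative_r_matrix_def)
  have snd_eq: "contract_snd scale (r x) \<alpha> = - contract_fst scale (r x) \<alpha>"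
    if "x \<in> X" "\<alpha> \<in> dual_space scale" for x \<alpha>
    using assms(5) that r_tensor
    by (intro contract_snd_eq_minus_contract_fst) (auto simp: skew_symmetric_family_def)
  have fst_eq: "contract_fst scale (r x) \<alpha> = - contract_snd scale (r x) \<alpha>"
    if "x \<in> X" "\<alpha> \<in> dual_space scale" for x \<alpha>
    using snd_eq[OF that] by simp
  have add: "contract_snd scale (r x) (\<alpha> + \<beta>) =
      contract_snd scale (r x) \<alpha> + contract_snd scale (r x) \<beta>"
    if "x \<in> X" "\<alpha> \<in> dual_space scale" "\<beta> \<in> dual_space scale" for x \<alpha> \<beta>
  proof -
    obtain f where "r x = tensor2_equiv scale `` {f}"
      using r_tensor[OF \<open>x \<in> X\<close>] by (rule tensor2_class_exists)
    moreover have "\<alpha> + \<beta> \<in> dual_space scale"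
      using B.subspace_M that(2,3) by (rule B.M.subspace_add)
    ultimately show ?thesis
      using that by (simp add: contract_snd_class frag_contract_functional_add)
  qed
  have scale: "contract_snd scale (r x) (dual_scale k \<alpha>) = scale k (contract_snd scale (r x) \<alpha>)"
    if "x \<in> X" "\<alpha> \<in> dual_space scale" for x k \<alpha>
  proof -
    obtain f where "r x = tensor2_equiv scale `` {f}"
      using r_tensor[OF \<open>x \<in> X\<close>] by (rule tensor2_class_exists)
    moreover have "dual_scale k \<alpha> \<in> dual_space scale"
      using B.subspace_M that(2) by (rule B.M.subspace_scale)
    ultimately show ?thesis
      using that by (simp add: contract_snd_class frag_contract_snd_dual_scale)
  qed
  have neg: "contract_snd scale (r y) (coadjoint_left (- a) \<beta>) =
      - contract_snd scale (r y) (coadjoint_left a \<beta>)"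
    if "y \<in> X" "\<beta> \<in> dual_space scale" for y a \<beta>
    using B.lact_scale_left[OF that(2), of "- 1" a] scale[OF that(1), of "coadjoint_left a \<beta>" "- 1"]
      that by (simp add: coadjoint_left_dual)
  have matching: "contract_snd scale (r x) \<alpha> * contract_snd scale (r y) \<beta> =
      contract_snd scale (r x) (coadjoint_right \<alpha> (contract_snd scale (r y) \<beta>)) +
      contract_snd scale (r y) (coadjoint_left (contract_snd scale (r x) \<alpha>) \<beta>)"
    if "x \<in> X" "y \<in> X" "\<alpha> \<in> dual_space scale" "\<beta> \<in> dual_space scale" for x y \<alpha> \<beta>
    using contracted_matching_Yang_Baxter[OF assms(4) that] that
    by (simp add: fst_eq neg coadjoint_right_dual algebra_simps)
  have "matching_relative_Rota_Baxter_algebra scale dual_scale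
      (dual_space scale) coadjoint_left coadjoint_right X (\<lambda>x \<alpha>. contract_snd scale (r x) \<alpha>)"
    by unfold_locales (simp_all only: add scale matching)
  with snd_eq show ?thesis by blast
qed

end
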